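(* Let $(s,\alpha)$ be such that $I_{\mathcal D}(s,\alpha)<+\infty$, let $\theta_{\mathcal D}$ be distributed according to $\pi_{\mathcal D}(\theta_{\mathcal D}\mid s,\alpha)$, and let $r$ be a positive integer. (1) For $D\in\mathcal D$ and $i_D\in\mathcal I_D^*$, the $r$th moment of the generalized odds ratio is $$E_{\pi_{\mathcal D}(\theta_{\mathcal D}\mid s,\alpha)}\Big(\Big(\prod_{F\subseteq D}p(i(F))^{(-1)^{|D\setminus F|}}\Big)^r\Big)=E_{\pi_{\mathcal D}(\theta_{\mathcal D}\mid s,\alpha)}\big(e^{r\theta(i_D)}\big)=\frac{I_{\mathcal D}(\tilde s_D,\alpha)}{I_{\mathcal D}(s,\alpha)},$$ where the components of $\tilde s_D$ are equal to those of $s$ except for $\tilde s_D(i_D)=s(i_D)+r$. (2) For all $E\subseteq V$ and $i_E\in\mathcal I_E^*$, the $r$th moment of the cell probability $p(i(E))$ is $$E_{\pi_{\mathcal D}(\theta_{\mathcal D}\mid s,\alpha)}\big(p(i(E))^r\big)=\frac{I_{\mathcal D}(\tilde s_{E,r},\alpha+r)}{I_{\mathcal D}(s,\alpha)},$$ where the components of $\tilde s_{E,r}$ are equal to those of $s$ except for $\tilde s_{E,r}(i_F)=s(i_F)+r$ for every $F\in\mathcal D$ with $F\subseteq E$ (here $i_F$ is the subvector of the given $i_E$). (Equalities are understood in $(0,+\infty]$.)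
   Context: $V$ is a finite nonempty set; for each $\gamma\in V$, $\mathcal I_\gamma$ is a finite set of levels with at least two elements, one of which is denoted $0$. The set of cells is $\mathcal I=\prod_{\gamma\in V}\mathcal I_\gamma$, and $i^*=(0,\dots,0)$. For $E\subseteq V$, $\mathcal I_E=\prod_{\gamma\in E}\mathcal I_\gamma$, and $\mathcal I_E^*=\{i_E\in\mathcal I_E:\ i_\gamma\neq 0\ \forall\gamma\in E\}$ (one element, the empty vector, if $E=\varnothing$). For $i_E\in\mathcal I_E^*$ and $F\subseteq E$, $i_F$ is the subvector of $i_E$ indexed by $F$, and $i(F)=(i_F,i^*_{F^c})\in\mathcal I$ is the cell agreeing with $i_F$ on $F$ and equal to $0$ off $F$. A hierarchical log-linear model is given by a generating class $\{A_1,\dots,A_k\}$ of subsets of $V$, and $\mathcal D=\{E\neq\varnothing:\ E\subseteq A_l\text{ for some }l\}$. Put $d_{\mathcal D}=\sum_{D\in\mathcal D}|\mathcal I_D^*|$. For $\theta_{\mathcal D}=(\theta(i_D),D\in\mathcal D,i_D\in\mathcal I_D^* )\in\mathbb R^{d_{\mathcal D}}$ let $$Z(\theta_{\mathcal D})=1+\sum_{E\subseteq V,\,E\ne\varnothing}\ \sum_{i_E\in\mathcal I_E^*}\exp\sum_{F\in\mathcal D,\,F\subseteq E}\theta(i_F),\qquad p(i(E))=\frac{\exp\sum_{F\in\mathcal D,\,F\subseteq E}\theta(i_F)}{Z(\theta_{\mathcal D})}\quad(E\subseteq V,\ i_E\in\mathcal I_E^* ),$$ with empty sums equal to $0$. For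 $s=(s(i_D),D\in\mathcal D,i_D\in\mathcal I_D^* )\in\mathbb R^{d_{\mathcal D}}$ and $\alpha\in\mathbb R$, the prior $\pi_{\mathcal D}$ has density with respect to Lebesgue measure on $\mathbb R^{d_{\mathcal D}}$ $$\pi_{\mathcal D}(\theta_{\mathcal D}\mid s,\alpha)=I_{\mathcal D}(s,\alpha)^{-1}\exp\Big\{\sum_{D\in\mathcal D}\sum_{i_D\in\mathcal I_D^*}\theta(i_D)s(i_D)-\alpha\log Z(\theta_{\mathcal D})\Big\},$$ where $I_{\mathcal D}(s,\alpha)\in(0,+\infty]$ is the integral over $\mathbb R^{d_{\mathcal D}}$ of the exponential factor. *)

theory Defs
  imports "HOL-Analysis.Analysis"
begin

definition nonzero_levels :: "('v \<Rightarrow> 'l::zero set) \<Rightarrow> 'v set \<Rightarrow> ('v \<Rightarrow> 'l) set" where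
  "nonzero_levels L E = (\<Pi>\<^sub>E \<gamma>\<in>E. L \<gamma> - {0})"

definition hierarchy :: "'v set set \<Rightarrow> 'v set set" where
  "hierarchy A = {E. E \<noteq> {} \<and> (\<exists>B\<in>A. E \<subseteq> B)}"

text \<open>A parameter vector, with components \<open>\<theta>(i\<^sub>D)\<close>, is a function on pairs \<open>(D, i\<^sub>D)\<close>. The set
  \<open>D\<close> is kept in the index because an extensional function need not determine its domain.\<close>

definition param_index :: "('v \<Rightarrow> 'l::zero set) \<Rightarrow> 'v set set \<Rightarrow> ('v set \<times> ('v \<Rightarrow> 'l)) set" where
  "param_index L \<D> = (SIGMA D:\<D>. nonzero_levels L D)"

definition cell :: "'v set \<Rightarrow> 'v set \<Rightarrow> ('v \<Rightarrow> 'l::zero) \<Rightarrow> 'v \<Rightarrow> 'l" where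
  "cell V E x = (\<lambda>\<gamma>\<in>V. if \<gamma> \<in> E then x \<gamma> else 0)"

definition cell_exponent ::
    "'v set set \<Rightarrow> ('v set \<times> ('v \<Rightarrow> 'l) \<Rightarrow> real) \<Rightarrow> 'v set \<Rightarrow> ('v \<Rightarrow> 'l) \<Rightarrow> real" where
  "cell_exponent \<D> \<theta> E x = (\<Sum>F | F \<in> \<D> \<and> F \<subseteq> E. \<theta> (F, restrict x F))"

definition Z :: "'v set \<Rightarrow> ('v \<Rightarrow> 'l::zero set) \<Rightarrow> 'v set set \<Rightarrow>
    ('v set \<times> ('v \<Rightarrow> 'l) \<Rightarrow> real) \<Rightarrow> real" where
  "Z V L \<D> \<theta> =
     1 + (\<Sum>E\<in>Pow V - {{}}. \<Sum>x\<in>nonzero_levels L E. exp (cell_exponent \<D> \<theta> E x))"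

text \<open>Cell probabilities are functions of the cell. Every cell \<open>i\<close> is \<open>i(E)\<close> for exactly one \<open>E\<close>,
  namely its support; lemma \<open>cell_prob_cell\<close> is the formula for \<open>p(i(E))\<close>.\<close>

definition cell_prob :: "'v set \<Rightarrow> ('v \<Rightarrow> 'l::zero set) \<Rightarrow> 'v set set \<Rightarrow>
    ('v set \<times> ('v \<Rightarrow> 'l) \<Rightarrow> real) \<Rightarrow> ('v \<Rightarrow> 'l) \<Rightarrow> real" where
  "cell_prob V L \<D> \<theta> i =
     (let E = {\<gamma>\<in>V. i \<gamma> \<noteq> 0} in exp (cell_exponent \<D> \<theta> E (restrict i E)) / Z V L \<D> \<theta>)"

lemma cell_prob_cell:
  assumes "E \<subseteq> V" "x \<in> nonzero_levels L E"
  shows "cell_prob V L \<D> \<theta> (cell V E x) = exp (cell_exponent \<D> \<theta> E x) / Z V L \<D> \<theta>"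
proof -
  have x: "x \<gamma> \<noteq> 0" if "\<gamma> \<in> E" for \<gamma>
    using PiE_mem[OF assms(2)[unfolded nonzero_levels_def] that] by simp
  have supp: "{\<gamma>\<in>V. cell V E x \<gamma> \<noteq> 0} = E"
    using assms(1) x unfolding cell_def by auto
  have arb: "x \<gamma> = undefined" if "\<gamma> \<notin> E" for \<gamma>
    using PiE_arb[OF assms(2)[unfolded nonzero_levels_def] that] .
  have "restrict (cell V E x) E = x"
    using assms(1) arb by (intro ext) (auto simp: cell_def restrict_def)
  then show ?thesis
    unfolding cell_prob_def Let_def supp by (simp only:)
qed

definition param_lebesgue :: "('v \<Rightarrow> 'l::zero set) \<Rightarrow> 'v set set \<Rightarrow>
    ('v set \<times> ('v \<Rightarrow> 'l) \<Rightarrow> real) measure" where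
  "param_lebesgue L \<D> = (\<Pi>\<^sub>M j\<in>param_index L \<D>. lborel)"

definition prior_kernel :: "'v set \<Rightarrow> ('v \<Rightarrow> 'l::zero set) \<Rightarrow> 'v set set \<Rightarrow>
    ('v set \<times> ('v \<Rightarrow> 'l) \<Rightarrow> real) \<Rightarrow> real \<Rightarrow> ('v set \<times> ('v \<Rightarrow> 'l) \<Rightarrow> real) \<Rightarrow> real" where
  "prior_kernel V L \<D> s \<alpha> \<theta> =
     exp ((\<Sum>D\<in>\<D>. \<Sum>x\<in>nonzero_levels L D. \<theta> (D, x) * s (D, x)) - \<alpha> * ln (Z V L \<D> \<theta>))"

definition prior_const :: "'v set \<Rightarrow> ('v \<Rightarrow> 'l::zero set) \<Rightarrow> 'v set set \<Rightarrow>
    ('v set \<times> ('v \<Rightarrow> 'l) \<Rightarrow> real) \<Rightarrow> real \<Rightarrow> ennreal" where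
  "prior_const V L \<D> s \<alpha> =
     (\<integral>\<^sup>+ \<theta>. ennreal (prior_kernel V L \<D> s \<alpha> \<theta>) \<partial>param_lebesgue L \<D>)"

definition prior :: "'v set \<Rightarrow> ('v \<Rightarrow> 'l::zero set) \<Rightarrow> 'v set set \<Rightarrow>
    ('v set \<times> ('v \<Rightarrow> 'l) \<Rightarrow> real) \<Rightarrow> real \<Rightarrow> ('v set \<times> ('v \<Rightarrow> 'l) \<Rightarrow> real) measure" where
  "prior V L \<D> s \<alpha> = density (param_lebesgue L \<D>)
     (\<lambda>\<theta>. inverse (prior_const V L \<D> s \<alpha>) * ennreal (prior_kernel V L \<D> s \<alpha> \<theta>))"

definition odds_ratio :: "'v set \<Rightarrow> ('v \<Rightarrow> 'l::zero set) \<Rightarrow> 'v set set \<Rightarrow>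
    ('v set \<times> ('v \<Rightarrow> 'l) \<Rightarrow> real) \<Rightarrow> 'v set \<Rightarrow> ('v \<Rightarrow> 'l) \<Rightarrow> real" where
  "odds_ratio V L \<D> \<theta> D x =
     (\<Prod>F\<in>Pow D. cell_prob V L \<D> \<theta> (cell V F (restrict x F)) powi ((- 1) ^ card (D - F)))"

end

theory Submission
  imports Defs
begin

text \<open>The prior is an exponential family in which every statistic of interest is itself
  the exponential of a linear function of \<open>\<theta>\<close> and \<open>log Z(\<theta>)\<close>. Multiplying the unnormalised density with
  hyperparameters \<open>(s, \<alpha>)\<close> by \<open>exp (c \<Sum>\<^bsub>j\<in>J\<^esub> \<theta>(j) - b log Z(\<theta>))\<close> gives the unnormalised density
  with \<open>s\<close> raised by \<open>c\<close> on \<open>J\<close> and \<open>\<alpha>\<close> raised by \<open>b\<close> (lemma \<open>prior_kernel_shift\<close>). Integrating, the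
  moment of such a statistic is a ratio of normalising constants (lemma \<open>nn_integral_prior\<close>).

  The \<open>r\<close>th power of \<open>p(i(E))\<close> has this form with \<open>J\<close> the set of the \<open>i\<^sub>F\<close> occurring in its exponent
  and \<open>b = c = r\<close>. For the generalised odds ratio, the point is that it equals \<open>exp \<theta>(i\<^sub>D)\<close>, which
  has powers of this form with \<open>b = 0\<close>. Indeed \<open>log p(i(F))\<close> is the sum over all \<open>G \<subseteq> F\<close> of the interaction terms
  \<open>\<theta>(i\<^sub>G)\<close>, where \<open>- log Z\<close> plays the part of the interaction of the empty set and the interactions
  of nonempty \<open>G \<notin> \<D>\<close> vanish; Moebius inversion on the subsets of \<open>D\<close> recovers the term at \<open>D\<close>, and \<open>log Z\<close>
  disappears because \<open>D\<close> is nonempty.\<close>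

lemma Z_pos: "Z V L \<D> \<theta> > 0"
  unfolding Z_def by (intro add_pos_nonneg sum_nonneg) auto

lemma restrict_nonzero_levels:
  assumes "x \<in> nonzero_levels L E" "F \<subseteq> E"
  shows "restrict x F \<in> nonzero_levels L F"
  using assms unfolding nonzero_levels_def by (auto simp: PiE_iff)

lemma measurable_prior_kernel: "prior_kernel V L \<D> s \<alpha> \<in> borel_measurable (param_lebesgue L \<D>)"
proof -
  have component: "(\<lambda>\<theta>. \<theta> j) \<in> borel_measurable (param_lebesgue L \<D>)"
    if "j \<in> param_index L \<D>" for j
    using measurable_component_singleton[OF that, of "\<lambda>_. lborel"]
    by (simp add: param_lebesgue_def)
  have exponent: "(\<lambda>\<theta>. cell_exponent \<D> \<theta> E x) \<in> borel_measurable (param_lebesgue L \<D>)"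
    if "x \<in> nonzero_levels L E" for E x
    unfolding cell_exponent_def using that
    by (intro borel_measurable_sum component) (auto simp: param_index_def restrict_nonzero_levels)
  have [measurable]: "(\<lambda>\<theta>. Z V L \<D> \<theta>) \<in> borel_measurable (param_lebesgue L \<D>)"
    unfolding Z_def
    by (intro borel_measurable_add borel_measurable_sum borel_measurable_const
        measurable_compose[OF exponent borel_measurable_exp])
  have [measurable]: "(\<lambda>\<theta>. \<Sum>D\<in>\<D>. \<Sum>x\<in>nonzero_levels L D. \<theta> (D, x) * s (D, x))
      \<in> borel_measurable (param_lebesgue L \<D>)"
    by (intro borel_measurable_sum borel_measurable_times component borel_measurable_const)
      (auto simp: param_index_def)
  show ?thesis
    unfolding prior_kernel_def by measurable
qed

text \<open>Since the kernel never vanishes, \<open>f\<close> is a quotient of two kernels, so its measurability comes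
  for free.\<close>

lemma nn_integral_prior:
  assumes reweight: "\<And>\<theta>. prior_kernel V L \<D> s' \<alpha>' \<theta> = f \<theta> * prior_kernel V L \<D> s \<alpha> \<theta>"
  shows "(\<integral>\<^sup>+ \<theta>. ennreal (f \<theta>) \<partial>prior V L \<D> s \<alpha>)
    = prior_const V L \<D> s' \<alpha>' / prior_const V L \<D> s \<alpha>"
proof -
  note measurable_prior_kernel [measurable]
  have kernel_pos: "prior_kernel V L \<D> s \<alpha> \<theta> > 0" for s \<alpha> \<theta>
    by (simp add: prior_kernel_def)
  have f: "f = (\<lambda>\<theta>. prior_kernel V L \<D> s' \<alpha>' \<theta> / prior_kernel V L \<D> s \<alpha> \<theta>)"
    using reweight kernel_pos[of s \<alpha>] by (auto simp: less_imp_neq[symmetric])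
  have [measurable]: "f \<in> borel_measurable (param_lebesgue L \<D>)"
    unfolding f by measurable
  have pointwise: "inverse c * ennreal (prior_kernel V L \<D> s \<alpha> \<theta>) * ennreal (f \<theta>)
      = ennreal (prior_kernel V L \<D> s' \<alpha>' \<theta>) / c" for c \<theta>
    using kernel_pos[of s \<alpha> \<theta>]
    by (simp add: reweight divide_ennreal_def ennreal_mult'' mult_ac)
  show ?thesis
    unfolding prior_def prior_const_def[of V L \<D> s' \<alpha>']
    by (subst nn_integral_density) (simp_all add: pointwise nn_integral_divide)
qed

text \<open>An exponential family is closed under tilting by its own statistics, because the exponent is
  linear in the hyperparameters. The two shifts are independent: powers of the odds ratio move only
  \<open>s\<close>, powers of a cell probability also move \<open>\<alpha>\<close> through their denominator \<open>Z\<close>.\<close>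

lemma prior_kernel_shift:
  assumes "finite \<D>" "\<And>D. D \<in> \<D> \<Longrightarrow> finite (nonzero_levels L D)" "J \<subseteq> param_index L \<D>"
  shows "prior_kernel V L \<D> (\<lambda>j. if j \<in> J then s j + c else s j) (\<alpha> + b) \<theta>
    = exp (c * (\<Sum>j\<in>J. \<theta> j) - b * ln (Z V L \<D> \<theta>)) * prior_kernel V L \<D> s \<alpha> \<theta>"
proof -
  have fin: "finite (param_index L \<D>)"
    unfolding param_index_def using assms by auto
  have flat: "(\<Sum>D\<in>\<D>. \<Sum>x\<in>nonzero_levels L D. \<theta> (D, x) * t (D, x))
      = (\<Sum>j\<in>param_index L \<D>. \<theta> j * t j)" for t
    unfolding param_index_def using assms by (subst sum.Sigma) (auto simp: case_prod_unfold)
  have "(\<Sum>j\<in>param_index L \<D>. \<theta> j * (if j \<in> J then s j + c else s j))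
      = (\<Sum>j\<in>param_index L \<D>. \<theta> j * s j + (if j \<in> J then c * \<theta> j else 0))"
    by (intro sum.cong) (auto simp: algebra_simps)
  also have "\<dots> = (\<Sum>j\<in>param_index L \<D>. \<theta> j * s j) + c * (\<Sum>j\<in>J. \<theta> j)"
    using fin assms(3) by (simp add: sum.distrib sum_distrib_left Int_absorb1 flip: sum.inter_restrict)
  finally show ?thesis
    unfolding prior_kernel_def flat[of s] flat[of "\<lambda>j. if j \<in> J then s j + c else s j"]
    by (simp add: algebra_simps flip: exp_add)
qed

text \<open>The logarithm of the odds ratio is the alternating sum over \<open>F \<subseteq> D\<close> of \<open>log p(i(F))\<close>, hence the
  Moebius inverse at \<open>D\<close> of a sum over subsets.\<close>

lemma odds_ratio_eq_exp:
  assumes D: "D \<in> \<D>" "D \<noteq> {}" "{} \<notin> \<D>" "D \<subseteq> V" "finite D" and x: "x \<in> nonzero_levels L D"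
  shows "odds_ratio V L \<D> \<theta> D x = exp (\<theta> (D, x))"
proof -
  define lnZ where "lnZ = ln (Z V L \<D> \<theta>)"
  \<comment> \<open>The logarithm of the normalisation enters as the interaction of the empty set.\<close>
  define f where "f G = (if G = {} then - lnZ else if G \<in> \<D> then \<theta> (G, restrict x G) else 0)" for G
  define g where "g F = cell_exponent \<D> \<theta> F x - lnZ" for F
  have g: "g F = sum f (Pow F)" if "finite F" for F
  proof -
    have "sum f (Pow F) = f {} + sum f (Pow F - {{}})"
      using that by (intro sum.remove) auto
    also have "sum f (Pow F - {{}}) = sum f {G \<in> \<D>. G \<subseteq> F}"
      using that D(3) by (intro sum.mono_neutral_right) (auto simp: f_def)
    also have "\<dots> = cell_exponent \<D> \<theta> F x"
      unfolding cell_exponent_def using D(3) by (intro sum.cong) (auto simp: f_def)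
    finally show ?thesis
      by (simp add: g_def f_def)
  qed
  have p: "cell_prob V L \<D> \<theta> (cell V F (restrict x F)) = exp (g F)" if "F \<subseteq> D" for F
  proof -
    have "cell_exponent \<D> \<theta> F (restrict x F) = cell_exponent \<D> \<theta> F x"
      unfolding cell_exponent_def by (intro sum.cong) (auto simp: Int_absorb1)
    then show ?thesis
      using that D(4) restrict_nonzero_levels[OF x that] Z_pos[of V L \<D> \<theta>]
      by (simp add: cell_prob_cell g_def lnZ_def exp_diff)
  qed
  have "odds_ratio V L \<D> \<theta> D x = (\<Prod>F\<in>Pow D. exp ((-1) ^ card (D - F) * g F))"
    unfolding odds_ratio_def by (intro prod.cong) (simp_all add: p exp_power_int)
  also have "\<dots> = exp (\<Sum>F\<in>Pow D. (-1) ^ card (D - F) * g F)"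
    using D(5) by (simp add: exp_sum)
  also have "(\<Sum>F\<in>Pow D. (-1) ^ card (D - F) * g F) = (\<Sum>F\<in>Pow D. (-1) ^ (card D - card F) * g F)"
    using D(5) by (intro sum.cong) (auto simp: card_Diff_subset finite_subset)
  also have "\<dots> = f D"
    using inclusion_exclusion_mobius[of g f D] g D(5) by simp
  also have "restrict x D = x"
    using x by (auto simp: nonzero_levels_def PiE_restrict)
  then have "f D = \<theta> (D, x)"
    using D by (simp add: f_def)
  finally show ?thesis .
qed

theorem proposition3p1:
  fixes V :: "'v set" and L :: "'v \<Rightarrow> 'l::zero set" and A :: "'v set set"
    and \<D> :: "'v set set"
    and s :: "'v set \<times> ('v \<Rightarrow> 'l) \<Rightarrow> real" and \<alpha> :: real and r :: nat
  assumes "finite V" and "V \<noteq> {}"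
    and "\<And>\<gamma>. \<gamma> \<in> V \<Longrightarrow> finite (L \<gamma>) \<and> card (L \<gamma>) \<ge> 2 \<and> 0 \<in> L \<gamma>"
    and "A \<subseteq> Pow V" and "\<D> = hierarchy A"
    and "prior_const V L \<D> s \<alpha> < \<infinity>"
    and "r > 0"
  shows "(\<forall>D\<in>\<D>. \<forall>x\<in>nonzero_levels L D.
            (\<integral>\<^sup>+ \<theta>. ennreal ((odds_ratio V L \<D> \<theta> D x) ^ r) \<partial>prior V L \<D> s \<alpha>)
              = (\<integral>\<^sup>+ \<theta>. ennreal (exp (real r * \<theta> (D, x))) \<partial>prior V L \<D> s \<alpha>)
          \<and> (\<integral>\<^sup>+ \<theta>. ennreal (exp (real r * \<theta> (D, x))) \<partial>prior V L \<D> s \<alpha>)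
              = prior_const V L \<D> (s((D, x) := s (D, x) + real r)) \<alpha> / prior_const V L \<D> s \<alpha>)
       \<and> (\<forall>E. E \<subseteq> V \<longrightarrow> (\<forall>x\<in>nonzero_levels L E.
            (\<integral>\<^sup>+ \<theta>. ennreal ((cell_prob V L \<D> \<theta> (cell V E x)) ^ r) \<partial>prior V L \<D> s \<alpha>)
              = prior_const V L \<D>
                  (\<lambda>(F, y). if F \<in> \<D> \<and> F \<subseteq> E \<and> y = restrict x F then s (F, y) + real r else s (F, y))
                  (\<alpha> + real r)
                / prior_const V L \<D> s \<alpha>))"
proof -
  have "\<D> \<subseteq> Pow V" and no_empty: "{} \<notin> \<D>"
    using assms(4,5) by (auto simp: hierarchy_def)
  then have sub: "D \<subseteq> V" if "D \<in> \<D>" for D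
    using that by auto
  have fin_\<D>: "finite \<D>"
    using \<open>\<D> \<subseteq> Pow V\<close> assms(1) by (auto intro: finite_subset)
  have fin_levels: "finite (nonzero_levels L D)" if "D \<in> \<D>" for D
    unfolding nonzero_levels_def using sub[OF that] assms(1,3)
    by (intro finite_PiE) (auto intro: finite_subset)
  note shift = prior_kernel_shift[OF fin_\<D> fin_levels, where V = V and s = s and \<alpha> = \<alpha>]
  show ?thesis
  proof (intro conjI ballI allI impI)
    fix D x assume D: "D \<in> \<D>" and x: "x \<in> nonzero_levels L D"
    have "odds_ratio V L \<D> \<theta> D x ^ r = exp (real r * \<theta> (D, x))" for \<theta>
      using odds_ratio_eq_exp[of D \<D> V x L \<theta>] D x sub[OF D] no_empty assms(1)
      by (metis exp_of_nat_mult finite_subset)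
    then show "(\<integral>\<^sup>+ \<theta>. ennreal ((odds_ratio V L \<D> \<theta> D x) ^ r) \<partial>prior V L \<D> s \<alpha>)
        = (\<integral>\<^sup>+ \<theta>. ennreal (exp (real r * \<theta> (D, x))) \<partial>prior V L \<D> s \<alpha>)"
      by simp
    have upd: "s((D, x) := s (D, x) + real r) = (\<lambda>j. if j \<in> {(D, x)} then s j + real r else s j)"
      by auto
    show "(\<integral>\<^sup>+ \<theta>. ennreal (exp (real r * \<theta> (D, x))) \<partial>prior V L \<D> s \<alpha>)
        = prior_const V L \<D> (s((D, x) := s (D, x) + real r)) \<alpha> / prior_const V L \<D> s \<alpha>"
      unfolding upd using shift[of "{(D, x)}" "real r" 0] D x
      by (intro nn_integral_prior) (auto simp: param_index_def)
  next
    fix E x assume E: "E \<subseteq> V" and x: "x \<in> nonzero_levels L E"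
    define J where "J = (\<lambda>F. (F, restrict x F)) ` {F \<in> \<D>. F \<subseteq> E}"
    have J: "J \<subseteq> param_index L \<D>"
      using x by (auto simp: J_def param_index_def restrict_nonzero_levels)
    have sum_J: "(\<Sum>j\<in>J. \<theta> j) = cell_exponent \<D> \<theta> E x" for \<theta> :: "_ \<Rightarrow> real"
      unfolding J_def cell_exponent_def by (subst sum.reindex) (auto simp: inj_on_def)
    have p: "cell_prob V L \<D> \<theta> (cell V E x) ^ r
        = exp (real r * (\<Sum>j\<in>J. \<theta> j) - real r * ln (Z V L \<D> \<theta>))" for \<theta>
      using Z_pos[of V L \<D> \<theta>]
      by (simp add: cell_prob_cell[OF E x] sum_J exp_of_nat_mult exp_diff power_divide)
    have upd: "(\<lambda>(F, y). if F \<in> \<D> \<and> F \<subseteq> E \<and> y = restrict x F then s (F, y) + real r else s (F, y))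
        = (\<lambda>j. if j \<in> J then s j + real r else s j)"
      by (auto simp: J_def)
    show "(\<integral>\<^sup>+ \<theta>. ennreal ((cell_prob V L \<D> \<theta> (cell V E x)) ^ r) \<partial>prior V L \<D> s \<alpha>)
        = prior_const V L \<D>
            (\<lambda>(F, y). if F \<in> \<D> \<and> F \<subseteq> E \<and> y = restrict x F then s (F, y) + real r else s (F, y))
            (\<alpha> + real r)
          / prior_const V L \<D> s \<alpha>"
      unfolding upd p using shift[OF _ J] by (intro nn_integral_prior) simp
  qed
qed

end
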